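(* Let $P=\operatorname{conv}(\{v^i\}_{i\in V})+\operatorname{cone}(\{r^j\}_{j\in E})\subseteq\mathbb{R}^n$ be a rational polyhedron with vertices $\{v^i\}_{i\in V}$ and extreme rays $\{r^j\}_{j\in E}$. Let $\{(\delta^l)^Tx\ge\delta^l_0\}_{l\in I}$ be a (possibly infinite) family of non-negative cuts for $P$ that all cut off the same set of vertices, i.e. there is $V^c\subseteq V$ with $V^c_{(\delta^l,\delta^l_0)}=V^c$ for all $l\in I$. Suppose that for every $\alpha^*>0$ and every $\beta^*\in\,]0,1]$: (1) for all $(i,j)\in V^c\times E$, the set of values $\{\alpha'_{i,j}(\delta^l,\delta^l_0) : l\in I,\ \alpha'_{i,j}(\delta^l,\delta^l_0)\ge\alpha^*\}$ is finite; and (2) for all $(i,k)\in V^c\times(V\setminus V^c)$, the set of values $\{\beta'_{i,k}(\delta^l,\delta^l_0) : l\in I,\ \beta'_{i,k}(\delta^l,\delta^l_0)\ge\beta^*\}$ is finite. Then the set $$X:=\{x\in P : (\delta^l)^Tx\ge\delta^l_0\ \text{for all } l\in I\}$$ is a polyhedron.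
   Context: $V$ and $E$ are finite index sets, $v^i\in\mathbb{Q}^n$, $r^j\in\mathbb{Z}^n$. An inequality $\delta^Tx\ge\delta_0$ is a cut for $P$ if $\delta^Tv^i<\delta_0$ for some $i\in V$. Put $V^c_{(\delta,\delta_0)}:=\{i\in V:\delta^Tv^i<\delta_0\}$ and $V^s_{(\delta,\delta_0)}:=V\setminus V^c_{(\delta,\delta_0)}$. A cut is non-negative if $\delta^Tr^j\ge0$ for all $j\in E$. For a non-negative cut, $i\in V^c_{(\delta,\delta_0)}$ and $j\in E$: $\alpha'_{i,j}(\delta,\delta_0):=\frac{\delta_0-\delta^Tv^i}{\delta^Tr^j}$ if $\delta^Tr^j>0$, and $\alpha'_{i,j}(\delta,\delta_0):=+\infty$ otherwise. For $i\in V^c_{(\delta,\delta_0)}$ and $k\in V^s_{(\delta,\delta_0)}$: $\beta'_{i,k}(\delta,\delta_0):=\frac{\delta_0-\delta^Tv^i}{\delta^T(v^k-v^i)}\in\,]0,1]$. *)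

theory Defs
  imports "HOL-Analysis.Analysis"
begin

definition recession_cone :: "'a::real_vector set \<Rightarrow> 'a set" where
  "recession_cone S = {d. \<forall>x\<in>S. \<forall>t\<ge>0. x + t *\<^sub>R d \<in> S}"

(* An extreme ray is a half-line, i.e. a set of directions; its generator is determined only
   up to a positive factor. *)
definition extreme_rays :: "'a::real_vector set \<Rightarrow> 'a set set" where
  "extreme_rays S =
     {R. R face_of recession_cone S \<and> (\<exists>d. d \<noteq> 0 \<and> R = conic hull {d})}"

definition verts_cut :: "'i set \<Rightarrow> ('i \<Rightarrow> 'a::real_inner) \<Rightarrow> 'a \<Rightarrow> real \<Rightarrow> 'i set" where
  "verts_cut V v \<delta> \<delta>\<^sub>0 = {i \<in> V. \<delta> \<bullet> v i < \<delta>\<^sub>0}"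

definition is_cut :: "'i set \<Rightarrow> ('i \<Rightarrow> 'a::real_inner) \<Rightarrow> 'a \<Rightarrow> real \<Rightarrow> bool" where
  "is_cut V v \<delta> \<delta>\<^sub>0 \<longleftrightarrow> (\<exists>i\<in>V. \<delta> \<bullet> v i < \<delta>\<^sub>0)"

definition nonneg_cut ::
  "'i set \<Rightarrow> ('i \<Rightarrow> 'a::real_inner) \<Rightarrow> 'j set \<Rightarrow> ('j \<Rightarrow> 'a) \<Rightarrow> 'a \<Rightarrow> real \<Rightarrow> bool" where
  "nonneg_cut V v E r \<delta> \<delta>\<^sub>0 \<longleftrightarrow> is_cut V v \<delta> \<delta>\<^sub>0 \<and> (\<forall>j\<in>E. \<delta> \<bullet> r j \<ge> 0)"

(* alpha' and beta' take a vertex v^i that is cut off, a ray r^j and a vertex v^k that is not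
   cut off; outside these cases the values are meaningless. *)
definition alpha' :: "'a::real_inner \<Rightarrow> 'a \<Rightarrow> 'a \<Rightarrow> real \<Rightarrow> ereal" where
  "alpha' vi rj \<delta> \<delta>\<^sub>0 =
     (if \<delta> \<bullet> rj > 0 then ereal ((\<delta>\<^sub>0 - \<delta> \<bullet> vi) / (\<delta> \<bullet> rj)) else \<infinity>)"

definition beta' :: "'a::real_inner \<Rightarrow> 'a \<Rightarrow> 'a \<Rightarrow> real \<Rightarrow> real" where
  "beta' vi vk \<delta> \<delta>\<^sub>0 = (\<delta>\<^sub>0 - \<delta> \<bullet> vi) / (\<delta> \<bullet> (vk - vi))"

end

theory Submission
  imports Defs
begin

text \<open>
  Order the cuts by their \<open>\<alpha>'\<close> and \<open>\<beta>'\<close> values. If all values of a cut \<open>l\<close> are bounded by those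
  of a cut \<open>m\<close>, then on \<open>P\<close> the inequality of \<open>l\<close> is implied by that of \<open>m\<close>: with \<open>M\<close> the largest
  ratio of the violations of \<open>l\<close> and \<open>m\<close> over the vertices cut off, the functional
  \<open>(\<delta> l \<bullet> x - \<delta>\<^sub>0 l) - M * (\<delta> m \<bullet> x - \<delta>\<^sub>0 m)\<close> is non-negative at all vertices and its linear part is
  non-negative on all rays. The finiteness hypotheses say that each value ranges over a set without
  infinite ascending chains, so by Dickson's lemma finitely many cuts dominate all others.
\<close>

text \<open>Induction on \<open>\<Phi>\<close>. If \<open>F\<close> dominates for
  \<open>\<Phi>\<close>, it also dominates in the new function \<open>g\<close> every
  \<open>l\<close> with \<open>g l \<le> t\<close>, where \<open>t\<close> is the least value of
  \<open>g\<close> on \<open>F\<close>. The values of \<open>g\<close> from \<open>t\<close> upwards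
  form a finite set \<open>W\<close>; on each level set of \<open>g\<close> the new function is
  constant, so the induction hypothesis, applied to that level set as index set, yields a finite
  dominating set there.\<close>

lemma dickson_finite_dominating:
  fixes \<Phi> :: "('l \<Rightarrow> 'b::linorder) set"
  assumes "finite \<Phi>"
    and "\<And>f l. f \<in> \<Phi> \<Longrightarrow> l \<in> I \<Longrightarrow> finite (f ` {m \<in> I. f l \<le> f m})"
  shows "\<exists>F\<subseteq>I. finite F \<and> (\<forall>l\<in>I. \<exists>m\<in>F. \<forall>f\<in>\<Phi>. f l \<le> f m)"
  using assms
proof (induction \<Phi> arbitrary: I rule: finite_induct)
  case empty
  show ?case
  proof (cases "I = {}")
    case False
    then obtain l where "l \<in> I" by blast
    then show ?thesis by (intro exI[of _ "{l}"]) auto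
  qed auto
next
  case (insert g \<Phi>)
  obtain F where F: "F \<subseteq> I" "finite F" "\<forall>l\<in>I. \<exists>m\<in>F. \<forall>f\<in>\<Phi>. f l \<le> f m"
    using insert.IH[of I] insert.prems by auto
  show ?case
  proof (cases "F = {}")
    case True
    then show ?thesis using F by auto
  next
    case False
    define t where "t = Min (g ` F)"
    have "t \<in> g ` F" using False F(2) unfolding t_def by (intro Min_in) auto
    then obtain p where p: "p \<in> F" "g p = t" by auto
    define W where "W = g ` {m \<in> I. t \<le> g m}"
    \<comment> \<open>The finiteness hypothesis only covers thresholds that are attained on
      \<open>I\<close>; \<open>t\<close> is one of them, being \<open>g p\<close> with
      \<open>p\<close> in \<open>F\<close>.\<close>
    have "finite W"
      using insert.prems[of g p] p F(1) unfolding W_def by auto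
    have "\<exists>G. G \<subseteq> {l \<in> I. g l = w} \<and> finite G \<and>
        (\<forall>l\<in>{l \<in> I. g l = w}. \<exists>m\<in>G. \<forall>f\<in>\<Phi>. f l \<le> f m)" for w
    proof (rule insert.IH)
      fix f l assume "f \<in> \<Phi>" "l \<in> {l \<in> I. g l = w}"
      then have "finite (f ` {m \<in> I. f l \<le> f m})" using insert.prems by auto
      then show "finite (f ` {m \<in> {l \<in> I. g l = w}. f l \<le> f m})"
        by (rule finite_subset[rotated]) auto
    qed
    then obtain G where G: "\<And>w. G w \<subseteq> {l \<in> I. g l = w}" "\<And>w. finite (G w)"
        "\<And>w. \<forall>l\<in>{l \<in> I. g l = w}. \<exists>m\<in>G w. \<forall>f\<in>\<Phi>. f l \<le> f m"
      by metis
    show ?thesis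
    proof (intro exI[of _ "F \<union> (\<Union>w\<in>W. G w)"] conjI ballI)
      show "F \<union> (\<Union>w\<in>W. G w) \<subseteq> I" using F(1) G(1) by blast
      show "finite (F \<union> (\<Union>w\<in>W. G w))" using F(2) G(2) \<open>finite W\<close> by auto
      fix l assume l: "l \<in> I"
      show "\<exists>m\<in>F \<union> (\<Union>w\<in>W. G w). \<forall>f\<in>insert g \<Phi>. f l \<le> f m"
      proof (cases "g l \<le> t")
        case True
        obtain m where m: "m \<in> F" "\<forall>f\<in>\<Phi>. f l \<le> f m" using F(3) l by blast
        have "t \<le> g m" unfolding t_def using m(1) F(2) by auto
        then show ?thesis using m True by (intro bexI[of _ m]) auto
      next
        case False
        then have "g l \<in> W" using l unfolding W_def by auto
        moreover obtain m where m: "m \<in> G (g l)" "\<forall>f\<in>\<Phi>. f l \<le> f m"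
          using G(3)[of "g l"] l by blast
        moreover have "g m = g l" using G(1) m(1) by blast
        ultimately show ?thesis by (intro bexI[of _ m]) auto
      qed
    qed
  qed
qed

lemma polyhedron_slice:
  fixes S :: "('a::euclidean_space \<times> 'b::euclidean_space) set"
  assumes "polyhedron S"
  shows "polyhedron {x. (x, c) \<in> S}"
proof -
  obtain F where F: "finite F" "S = \<Inter>F" "\<And>h. h \<in> F \<Longrightarrow> \<exists>a b. a \<noteq> 0 \<and> h = {x. a \<bullet> x \<le> b}"
    using assms unfolding polyhedron_def by metis
  have "{x. (x, c) \<in> S} = \<Inter>((\<lambda>h. {x. (x, c) \<in> h}) ` F)"
    using F(2) by auto
  moreover have "polyhedron {x. (x, c) \<in> h}" if "h \<in> F" for h
  proof -
    obtain a b where "h = {x. (a::'a \<times> 'b) \<bullet> x \<le> b}" using F(3)[OF \<open>h \<in> F\<close>] by blast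
    \<comment> \<open>If \<open>fst a = 0\<close>, this set is empty or the whole space, which
      \<open>polyhedron_halfspace_le\<close> covers as well.\<close>
    then have "{x. (x, c) \<in> h} = {x. fst a \<bullet> x \<le> b - snd a \<bullet> c}"
      by (auto simp: inner_prod_def algebra_simps)
    then show ?thesis using polyhedron_halfspace_le by metis
  qed
  ultimately show ?thesis using F(1) by auto
qed

lemma polyhedron_finitely_generated:
  fixes A B :: "'a::euclidean_space set"
  assumes "finite A" "finite B"
  shows "polyhedron {x + y | x y. x \<in> convex hull A \<and> y \<in> convex_cone hull B}"
proof -
  \<comment> \<open>Homogenize: the set is the slice at height 1 of the cone generated by \<open>A \<times> {1}\<close> and \<open>B \<times> {0}\<close>.\<close>
  have lin: "linear (\<lambda>y::'a. (y, 0::real))"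
    by (rule linearI) auto
  have hB: "convex_cone hull ((\<lambda>y. (y, 0::real)) ` B) = (\<lambda>y. (y, 0)) ` (convex_cone hull B)"
    using convex_cone_hull_linear_image[OF lin] by simp
  have hA: "convex_cone hull (A \<times> {1::real}) = insert 0 {c *\<^sub>R (x, 1) | c x. 0 \<le> c \<and> x \<in> convex hull A}"
    unfolding convex_cone_hull_separate conic_hull_explicit convex_hull_Times by auto
  have "{x + y | x y. x \<in> convex hull A \<and> y \<in> convex_cone hull B} =
      {x. (x, 1) \<in> convex_cone hull (A \<times> {1} \<union> (\<lambda>y. (y, 0::real)) ` B)}"
    \<comment> \<open>An element of the cone is a sum of a part from \<open>hA\<close> and a part of
      height 0, so height 1 rules out the inserted 0 and forces \<open>c = 1\<close>.\<close>
    unfolding convex_cone_hull_Un hA hB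
    by (force simp: zero_prod_def)
  then show ?thesis
    using assms by (simp add: polyhedron_slice polyhedron_convex_cone_hull)
qed

lemma affine_nonneg_on_finitely_generated:
  fixes a :: "'a::real_inner"
  assumes "x \<in> {y + z | y z. y \<in> convex hull A \<and> z \<in> convex_cone hull B}"
    and A: "\<And>y. y \<in> A \<Longrightarrow> b \<le> a \<bullet> y"
    and B: "\<And>z. z \<in> B \<Longrightarrow> 0 \<le> a \<bullet> z"
  shows "b \<le> a \<bullet> x"
proof -
  obtain y z where yz: "x = y + z" "y \<in> convex hull A" "z \<in> convex_cone hull B"
    using assms(1) by blast
  have "convex hull A \<subseteq> {y. a \<bullet> y \<ge> b}"
    using A by (intro hull_minimal convex_halfspace_ge) auto
  moreover have "convex_cone hull B \<subseteq> {z. 0 \<le> a \<bullet> z}"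
    using B by (intro hull_minimal convex_cone_halfspace_ge) auto
  ultimately show ?thesis
    using yz by (force simp: inner_add_right)
qed

text \<open>The factor is the ratio of the two violations at \<open>x\<close>. A finite
  \<open>alpha'\<close> for \<open>e\<close> forces a finite one for \<open>d\<close>, and
  cross-multiplying gives the claim; an infinite one means \<open>e \<bullet> r = 0\<close>, so the
  left side vanishes.\<close>

lemma alpha'_le_imp:
  assumes "alpha' x r d d0 \<le> alpha' x r e e0"
    and "d \<bullet> x < d0" "e \<bullet> x < e0" "0 \<le> d \<bullet> r" "0 \<le> e \<bullet> r"
  shows "(d0 - d \<bullet> x) / (e0 - e \<bullet> x) * (e \<bullet> r) \<le> d \<bullet> r"
proof (cases "e \<bullet> r > 0")
  case True
  then have "d \<bullet> r > 0" "(d0 - d \<bullet> x) / (d \<bullet> r) \<le> (e0 - e \<bullet> x) / (e \<bullet> r)"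
    using assms(1) by (auto simp: alpha'_def split: if_splits)
  then show ?thesis
    using True assms(2,3) by (simp add: field_simps)
next
  case False
  then have "e \<bullet> r = 0" using assms(5) by simp
  then show ?thesis using assms(4) by simp
qed

text \<open>With violation \<open>a\<close> at \<open>x\<close> and slack \<open>b\<close> at
  \<open>y\<close>, \<open>beta'\<close> is \<open>a / (a + b)\<close>. Comparing two such fractions
  amounts to \<open>a * b' \<le> a' * b\<close>, also when a slack is 0.\<close>

lemma beta'_le_imp:
  assumes "beta' x y d d0 \<le> beta' x y e e0"
    and "d \<bullet> x < d0" "e \<bullet> x < e0" "d0 \<le> d \<bullet> y" "e0 \<le> e \<bullet> y"
  shows "(d0 - d \<bullet> x) / (e0 - e \<bullet> x) * (e \<bullet> y - e0) \<le> d \<bullet> y - d0"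
proof -
  define a where "a = d0 - d \<bullet> x"
  define a' where "a' = e0 - e \<bullet> x"
  define b where "b = d \<bullet> y - d0"
  define b' where "b' = e \<bullet> y - e0"
  have pos: "a > 0" "a' > 0" "b \<ge> 0" "b' \<ge> 0"
    using assms(2-5) by (auto simp: a_def a'_def b_def b'_def)
  have "a / (a + b) \<le> a' / (a' + b')"
    using assms(1) by (simp add: beta'_def a_def a'_def b_def b'_def inner_diff_right)
  then have "a * b' \<le> a' * b"
    using pos by (simp add: divide_simps algebra_simps)
  then have "a / a' * b' \<le> b"
    using pos by (simp add: field_simps)
  then show ?thesis
    by (simp add: a_def a'_def b_def b'_def)
qed

lemma dominated_cut_implied:
  fixes v :: "'i \<Rightarrow> 'a::real_inner"
  assumes fin: "finite V"
    and x: "x \<in> {y + z | y z. y \<in> convex hull (v ` V) \<and> z \<in> convex_cone hull (r ` E)}"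
    and d: "nonneg_cut V v E r d d0" and e: "nonneg_cut V v E r e e0"
    and Vc: "verts_cut V v d d0 = Vc" "verts_cut V v e e0 = Vc"
    and alpha: "\<And>i j. i \<in> Vc \<Longrightarrow> j \<in> E \<Longrightarrow> alpha' (v i) (r j) d d0 \<le> alpha' (v i) (r j) e e0"
    and beta: "\<And>i k. i \<in> Vc \<Longrightarrow> k \<in> V - Vc \<Longrightarrow> beta' (v i) (v k) d d0 \<le> beta' (v i) (v k) e e0"
    and ex: "e0 \<le> e \<bullet> x"
  shows "d0 \<le> d \<bullet> x"
proof -
  define q where "q i = (d0 - d \<bullet> v i) / (e0 - e \<bullet> v i)" for i
  have cut: "d \<bullet> v i < d0" "e \<bullet> v i < e0" "i \<in> V" if "i \<in> Vc" for i
    using that Vc unfolding verts_cut_def by auto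
  have sat: "d0 \<le> d \<bullet> v k" "e0 \<le> e \<bullet> v k" if "k \<in> V - Vc" for k
    using that Vc unfolding verts_cut_def by force+
  have ray: "0 \<le> d \<bullet> r j" "0 \<le> e \<bullet> r j" if "j \<in> E" for j
    using that d e by (auto simp: nonneg_cut_def)
  have finVc: "finite Vc"
    using fin cut(3) by (meson finite_subset subsetI)
  have "Vc \<noteq> {}"
    using d Vc(1) by (auto simp: nonneg_cut_def is_cut_def verts_cut_def)
  then have "Max (q ` Vc) \<in> q ` Vc" using finVc by (intro Max_in) auto
  \<comment> \<open>Maximality of \<open>q i\<close> is needed at the vertices cut off; at the
    remaining vertices and on the rays the comparison of \<open>beta'\<close> and
    \<open>alpha'\<close> at this one \<open>i\<close> suffices.\<close>
  then obtain i where i: "i \<in> Vc" "q i = Max (q ` Vc)" by auto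
  have "d0 - q i * e0 \<le> (d - q i *\<^sub>R e) \<bullet> x"
  proof (rule affine_nonneg_on_finitely_generated[OF x])
    fix y assume "y \<in> v ` V"
    then obtain k where k: "k \<in> V" "y = v k" by auto
    show "d0 - q i * e0 \<le> (d - q i *\<^sub>R e) \<bullet> y"
    proof (cases "k \<in> Vc")
      case True
      then have "q k \<le> q i" using i finVc by simp
      then have "d0 - d \<bullet> v k \<le> q i * (e0 - e \<bullet> v k)"
        using cut(2)[OF True] by (simp add: q_def pos_divide_le_eq)
      then show ?thesis using k by (simp add: algebra_simps)
    next
      case False
      then have "q i * (e \<bullet> v k - e0) \<le> d \<bullet> v k - d0"
        using beta'_le_imp[OF beta[OF i(1)], of k] cut[OF i(1)] sat[of k] k(1) by (simp add: q_def)
      then show ?thesis using k by (simp add: algebra_simps)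
    qed
  next
    fix z assume "z \<in> r ` E"
    then obtain j where j: "j \<in> E" "z = r j" by auto
    have "q i * (e \<bullet> r j) \<le> d \<bullet> r j"
      using alpha'_le_imp[OF alpha[OF i(1) j(1)]] cut[OF i(1)] ray[OF j(1)] by (simp add: q_def)
    then show "0 \<le> (d - q i *\<^sub>R e) \<bullet> z" using j by (simp add: inner_diff_left)
  qed
  moreover have "q i \<ge> 0" using cut[OF i(1)] by (simp add: q_def)
  then have "q i * e0 \<le> q i * (e \<bullet> x)" using ex by (rule mult_left_mono[rotated])
  ultimately show ?thesis by (simp add: inner_diff_left)
qed

theorem theorem3p1:
  fixes V :: "'i set" and v :: "'i \<Rightarrow> real ^ 'n"
    and E :: "'j set" and r :: "'j \<Rightarrow> real ^ 'n"
    and P :: "(real ^ 'n) set"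
    and I :: "'l set" and \<delta> :: "'l \<Rightarrow> real ^ 'n" and \<delta>\<^sub>0 :: "'l \<Rightarrow> real"
    and Vc :: "'i set"
  assumes "finite V" and "finite E"
    and v_rational: "\<And>i m. i \<in> V \<Longrightarrow> v i $ m \<in> \<rat>"
    and r_integral: "\<And>j m. j \<in> E \<Longrightarrow> r j $ m \<in> \<int>"
    and P: "P = {x + y | x y. x \<in> convex hull (v ` V) \<and> y \<in> convex_cone hull (r ` E)}"
    and vertices: "v ` V = {x. x extreme_point_of P}"
    and rays: "(\<lambda>j. conic hull {r j}) ` E = extreme_rays P"
    and cuts: "\<And>l. l \<in> I \<Longrightarrow> nonneg_cut V v E r (\<delta> l) (\<delta>\<^sub>0 l)"
    and "Vc \<subseteq> V"
    and same_vertices: "\<And>l. l \<in> I \<Longrightarrow> verts_cut V v (\<delta> l) (\<delta>\<^sub>0 l) = Vc"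
    and finite_alpha: "\<And>\<alpha> i j. \<alpha> > (0::real) \<Longrightarrow> i \<in> Vc \<Longrightarrow> j \<in> E \<Longrightarrow>
      finite {alpha' (v i) (r j) (\<delta> l) (\<delta>\<^sub>0 l) | l.
        l \<in> I \<and> alpha' (v i) (r j) (\<delta> l) (\<delta>\<^sub>0 l) \<ge> ereal \<alpha>}"
    and finite_beta: "\<And>\<beta> i k. \<beta> \<in> {0<..1} \<Longrightarrow> i \<in> Vc \<Longrightarrow> k \<in> V - Vc \<Longrightarrow>
      finite {beta' (v i) (v k) (\<delta> l) (\<delta>\<^sub>0 l) | l.
        l \<in> I \<and> beta' (v i) (v k) (\<delta> l) (\<delta>\<^sub>0 l) \<ge> \<beta>}"
  shows "polyhedron {x \<in> P. \<forall>l\<in>I. \<delta> l \<bullet> x \<ge> \<delta>\<^sub>0 l}"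
proof -
  \<comment> \<open>The values of \<open>beta'\<close> are embedded into the extended reals so that
    all functions share one linearly ordered type.\<close>
  define \<Phi> where "\<Phi> = (\<lambda>(i, j) l. alpha' (v i) (r j) (\<delta> l) (\<delta>\<^sub>0 l)) ` (Vc \<times> E) \<union>
    (\<lambda>(i, k) l. ereal (beta' (v i) (v k) (\<delta> l) (\<delta>\<^sub>0 l))) ` (Vc \<times> (V - Vc))"
  have cut: "\<delta> l \<bullet> v i < \<delta>\<^sub>0 l" if "l \<in> I" "i \<in> Vc" for l i
    using same_vertices[OF that(1)] that(2) unfolding verts_cut_def by auto
  have sat: "\<delta>\<^sub>0 l \<le> \<delta> l \<bullet> v k" if "l \<in> I" "k \<in> V - Vc" for l k
    using same_vertices[OF that(1)] that(2) unfolding verts_cut_def by force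
  have "finite Vc" using \<open>finite V\<close> \<open>Vc \<subseteq> V\<close> by (rule rev_finite_subset)
  then have "finite \<Phi>" unfolding \<Phi>_def using \<open>finite V\<close> \<open>finite E\<close> by simp
  moreover have "finite (f ` {m \<in> I. f l \<le> f m})" if f: "f \<in> \<Phi>" and l: "l \<in> I" for f l
    using f unfolding \<Phi>_def
  proof (elim UnE imageE, goal_cases)
    case (1 p)
    obtain i j where p: "p = (i, j)" "i \<in> Vc" "j \<in> E" using 1 by auto
    have f: "f = (\<lambda>l. alpha' (v i) (r j) (\<delta> l) (\<delta>\<^sub>0 l))" using 1 p by simp
    \<comment> \<open>The hypothesis wants a real threshold, whereas \<open>f l\<close> may be
      infinite; in that case any positive real lies below it, for instance 1.\<close>
    obtain \<alpha> where \<alpha>: "\<alpha> > 0" "ereal \<alpha> \<le> f l"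
    proof (cases "\<delta> l \<bullet> r j > 0")
      case True
      then show ?thesis
        using that[of "(\<delta>\<^sub>0 l - \<delta> l \<bullet> v i) / (\<delta> l \<bullet> r j)"] cut[OF l p(2)] by (simp add: f alpha'_def)
    next
      case False
      then show ?thesis using that[of 1] by (simp add: f alpha'_def)
    qed
    show ?case
      by (rule finite_subset[OF _ finite_alpha[OF \<alpha>(1) p(2,3)]])
        (use \<alpha>(2) in \<open>auto simp: f intro: order_trans\<close>)
  next
    case (2 p)
    obtain i k where p: "p = (i, k)" "i \<in> Vc" "k \<in> V - Vc" using 2 by auto
    define \<beta> where "\<beta> l = beta' (v i) (v k) (\<delta> l) (\<delta>\<^sub>0 l)" for l
    have f: "f = (\<lambda>l. ereal (\<beta> l))" using 2 p by (simp add: \<beta>_def)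
    \<comment> \<open>The denominator is the positive violation at \<open>v i\<close> plus the
      non-negative slack at \<open>v k\<close>. Hence \<open>\<beta> l\<close> itself is an
      admissible threshold.\<close>
    have "\<beta> l \<in> {0<..1}"
      using cut[OF l p(2)] sat[OF l p(3)] by (simp add: \<beta>_def beta'_def inner_diff_right)
    then have "finite {\<beta> m | m. m \<in> I \<and> \<beta> m \<ge> \<beta> l}"
      using finite_beta[OF _ p(2,3)] unfolding \<beta>_def by blast
    then have "finite (ereal ` {\<beta> m | m. m \<in> I \<and> \<beta> m \<ge> \<beta> l})" by (rule finite_imageI)
    then show ?case
      by (rule rev_finite_subset) (auto simp: f)
  qed
  ultimately obtain F where F: "F \<subseteq> I" "finite F" "\<And>l. l \<in> I \<Longrightarrow> \<exists>m\<in>F. \<forall>f\<in>\<Phi>. f l \<le> f m"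
    using dickson_finite_dominating[of \<Phi> I] by blast
  have implied: "\<delta>\<^sub>0 l \<le> \<delta> l \<bullet> x" if x: "x \<in> P" "\<forall>m\<in>F. \<delta>\<^sub>0 m \<le> \<delta> m \<bullet> x" and l: "l \<in> I" for x l
  proof -
    obtain m where m: "m \<in> F" and dom: "\<forall>f\<in>\<Phi>. f l \<le> f m" using F(3)[OF l] by blast
    then have mI: "m \<in> I" using F(1) by blast
    have "alpha' (v i) (r j) (\<delta> l) (\<delta>\<^sub>0 l) \<le> alpha' (v i) (r j) (\<delta> m) (\<delta>\<^sub>0 m)"
      if "i \<in> Vc" "j \<in> E" for i j
      using that dom unfolding \<Phi>_def by force
    moreover have "beta' (v i) (v k) (\<delta> l) (\<delta>\<^sub>0 l) \<le> beta' (v i) (v k) (\<delta> m) (\<delta>\<^sub>0 m)"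
      if "i \<in> Vc" "k \<in> V - Vc" for i k
      using that dom unfolding \<Phi>_def by force
    ultimately show ?thesis
      using dominated_cut_implied[OF \<open>finite V\<close> _ cuts[OF l] cuts[OF mI] same_vertices[OF l]
          same_vertices[OF mI], of x] x m P by blast
  qed
  have "{x \<in> P. \<forall>l\<in>I. \<delta> l \<bullet> x \<ge> \<delta>\<^sub>0 l} = P \<inter> \<Inter>((\<lambda>l. {x. \<delta> l \<bullet> x \<ge> \<delta>\<^sub>0 l}) ` F)"
    using implied F(1) by auto
  moreover have "polyhedron P"
    unfolding P using \<open>finite V\<close> \<open>finite E\<close> by (intro polyhedron_finitely_generated) auto
  ultimately show ?thesis
    using F(2) by (auto intro!: polyhedron_Int polyhedron_Inter polyhedron_halfspace_ge)
qed

end
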